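(* Let $0<T<\infty$ and let $h$ be given as the Laplace transform of a positive Borel measure $\mu$ defined on $\mathbb{R}_+$, i.e. $h(t)=\int_{\mathbb{R}_+}e^{-st}\,d\mu(s)$ for $t>0$. Then the truncated Hankel operator $\Gamma_h$ on $L^2(0,T)$ given by $$\Gamma_hu(t)=\int_0^Th(t+\tau)u(\tau)\,d\tau$$ is bounded if and only if there is a constant $C>0$ such that $\mu(0,x)\le Cx$ for all $x\ge 1$.
   Context: $\mathbb{R}_+=(0,\infty)$ and $\mu(0,x)$ denotes the $\mu$-measure of the interval $(0,x)$. Only the values of $h$ on $(0,2T)$ enter the definition of $\Gamma_h$. *)

theory Defs
  imports "HOL-Analysis.Analysis"
begin

text \<open>
  \<open>L\<^sup>2\<close> is rendered by its representatives: square-integrable measurable functions, with the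
  seminorm that vanishes exactly on the functions that are zero almost everywhere.
\<close>

definition L2_space :: "'a measure \<Rightarrow> ('a \<Rightarrow> complex) set" where
  "L2_space M = {u \<in> borel_measurable M. integrable M (\<lambda>x. (cmod (u x))\<^sup>2)}"

definition L2_norm :: "'a measure \<Rightarrow> ('a \<Rightarrow> complex) \<Rightarrow> real" where
  "L2_norm M u = sqrt (\<integral>x. (cmod (u x))\<^sup>2 \<partial>M)"

text \<open>
  The map must send the whole space into itself; a norm bound alone would not suffice, because
  the Bochner integral in \<open>L2_norm\<close> is 0 on functions that are not square-integrable.
\<close>

definition L2_bounded :: "'a measure \<Rightarrow> (('a \<Rightarrow> complex) \<Rightarrow> ('a \<Rightarrow> complex)) \<Rightarrow> bool" where
  "L2_bounded M A \<longleftrightarrow>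
     (\<forall>u \<in> L2_space M. A u \<in> L2_space M) \<and>
     (\<exists>C. \<forall>u \<in> L2_space M. L2_norm M (A u) \<le> C * L2_norm M u)"

definition lborel_upto :: "real \<Rightarrow> real measure" where
  "lborel_upto T = restrict_space lborel {0<..<T}"

text \<open>
  For \<open>h\<close> a convergent Laplace transform of a positive measure, \<open>h\<close> is decreasing on the positive
  half-line, so for \<open>t > 0\<close> and \<open>u\<close> in \<open>L\<^sup>2(0,T)\<close> the integrand below is integrable and the default
  value of the Bochner integral plays no role.
\<close>

definition truncated_hankel :: "real \<Rightarrow> (real \<Rightarrow> real) \<Rightarrow> (real \<Rightarrow> complex) \<Rightarrow> real \<Rightarrow> complex" where
  "truncated_hankel T h u t = (\<integral>\<tau>. complex_of_real (h (t + \<tau>)) * u \<tau> \<partial>(lborel_upto T))"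

end

theory Submission imports Defs begin

text \<open>
  Both properties are equivalent to a third one, the pointwise bound \<open>h t \<le> K / t\<close> for \<open>0 < t < 2T\<close>,
  and it is this bound that connects them.

  The bound and the operator. If \<open>h t \<le> K / t\<close>, the kernel \<open>h (t + \<tau>)\<close> is dominated by \<open>K\<close> times
  Hilbert's kernel \<open>1 / (t + \<tau>)\<close>, which is bounded on \<open>L\<^sup>2\<close> by Schur's test with the weight
  \<open>1 / sqrt \<tau>\<close> (\<open>L2_bounded_Schur_test\<close>, \<open>nn_integral_Hilbert_kernel_weight\<close>,
  \<open>L2_bounded_truncated_hankel\<close>). Conversely, \<open>h\<close> is decreasing, so the operator maps the
  indicator of \<open>(0,a)\<close>, of norm \<open>sqrt a\<close>, to a function that is at least \<open>a * h (2a)\<close> on \<open>(0,a)\<close>;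
  hence \<open>a * h (2a)\<close> is at most the operator norm (\<open>truncated_hankel_bounded_imp_le\<close>).

  The bound and the measure. On \<open>(0,x)\<close> the function \<open>exp (-s/x)\<close> is at least \<open>exp (-1)\<close>, so
  \<open>\<mu>(0,x) \<le> exp 1 * h (1/x)\<close> (\<open>emeasure_le_laplace\<close>). In the other direction, cutting the half-line into
  intervals of length \<open>1/t\<close> turns linear growth of \<open>\<mu>(0,x)\<close> into a convergent series for
  \<open>t * h t\<close> (\<open>laplace_le_of_linear_growth\<close>).

  Small \<open>t\<close> corresponds to large \<open>x\<close>. The thresholds \<open>t < 2T\<close> and \<open>x \<ge> 1\<close> do not match under
  \<open>x = 1/t\<close>, which only changes constants: \<open>h\<close> and \<open>\<mu>(0,x)\<close> are monotone and finite.
\<close>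

section \<open>The space on the bounded interval\<close>

lemma space_lborel_upto [simp]: "space (lborel_upto T) = {0<..<T}"
  by (simp add: lborel_upto_def space_restrict_space)

lemma emeasure_lborel_upto:
  assumes "0 \<le> a" "a \<le> b" "b \<le> T"
  shows "emeasure (lborel_upto T) {a<..<b} = ennreal (b - a)"
proof -
  have "emeasure (lborel_upto T) {a<..<b} = emeasure lborel {a<..<b}"
    unfolding lborel_upto_def using assms by (intro emeasure_restrict_space) auto
  then show ?thesis using assms by simp
qed

lemma finite_measure_lborel_upto: "finite_measure (lborel_upto T)"
proof
  show "emeasure (lborel_upto T) (space (lborel_upto T)) \<noteq> \<infinity>"
  proof (cases "0 \<le> T")
    case True
    then show ?thesis using emeasure_lborel_upto[of 0 T T] by simp
  next
    case False
    then have "space (lborel_upto T) = {}" by simp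
    then show ?thesis by (metis emeasure_empty ennreal_zero_neq_top infinity_ennreal_def)
  qed
qed

lemma borel_measurable_sum_kernel:
  assumes h: "h \<in> borel_measurable (restrict_space borel {0<..})"
  shows "(\<lambda>(t, s). h (t + s)) \<in> borel_measurable (lborel_upto T \<Otimes>\<^sub>M lborel_upto T)"
proof -
  have fst: "(\<lambda>x. fst x :: real) \<in> borel_measurable (lborel_upto T \<Otimes>\<^sub>M lborel_upto T)"
    and snd: "(\<lambda>x. snd x :: real) \<in> borel_measurable (lborel_upto T \<Otimes>\<^sub>M lborel_upto T)"
    by (auto simp: lborel_upto_def
        intro!: measurable_compose[OF measurable_fst] measurable_compose[OF measurable_snd]
          measurable_restrict_space1)
  have "(\<lambda>x. fst x + snd x) \<in> measurable (lborel_upto T \<Otimes>\<^sub>M lborel_upto T) (restrict_space borel {0<..})"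
    using fst snd by (intro measurable_restrict_space2) (auto simp: space_pair_measure)
  from measurable_compose[OF this h] show ?thesis
    by (simp add: case_prod_beta)
qed

section \<open>Schur's test\<close>

text \<open>
  Splitting the integrand as \<open>k |u| = sqrt (k w) * (sqrt (k / w) |u|)\<close>, the Cauchy-Schwarz inequality
  and the row bound give \<open>|Au(t)|\<^sup>2 \<le> B w(t) \<integral> k(t,s) |u(s)|\<^sup>2 / w(s) ds\<close>. Integrating over \<open>t\<close> first,
  the column bound cancels the weight and leaves \<open>B\<^sup>2 |u|\<^sup>2\<close>. All estimates are made for integrals
  with values in the extended nonnegative reals, where Tonelli's theorem applies before anything
  is known to be integrable.
\<close>

lemma L2_bounded_Schur_test:
  fixes k :: "'a \<Rightarrow> 'a \<Rightarrow> real" and w :: "'a \<Rightarrow> real"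
  assumes "sigma_finite_measure M"
    and k_meas: "(\<lambda>(t, s). k t s) \<in> borel_measurable (M \<Otimes>\<^sub>M M)"
    and k_nonneg: "\<And>t s. t \<in> space M \<Longrightarrow> s \<in> space M \<Longrightarrow> 0 \<le> k t s"
    and w_meas [measurable]: "w \<in> borel_measurable M"
    and w_pos: "\<And>t. t \<in> space M \<Longrightarrow> 0 < w t"
    and "0 \<le> B"
    and row: "\<And>t. t \<in> space M \<Longrightarrow> (\<integral>\<^sup>+s. ennreal (k t s * w s) \<partial>M) \<le> ennreal (B * w t)"
    and col: "\<And>s. s \<in> space M \<Longrightarrow> (\<integral>\<^sup>+t. ennreal (k t s * w t) \<partial>M) \<le> ennreal (B * w s)"
  shows "L2_bounded M (\<lambda>u t. \<integral>s. complex_of_real (k t s) * u s \<partial>M)"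
proof -
  interpret M: sigma_finite_measure M by fact
  interpret MM: pair_sigma_finite M M ..
  define A where "A = (\<lambda>u t. \<integral>s. complex_of_real (k t s) * u s \<partial>M)"
  have kk [measurable]: "(\<lambda>x. k (fst x) (snd x)) \<in> borel_measurable (M \<Otimes>\<^sub>M M)"
    using k_meas by (simp add: case_prod_beta)
  have k1 [measurable]: "k t \<in> borel_measurable M" if "t \<in> space M" for t
    using measurable_compose[OF measurable_Pair1'[OF that] k_meas] by simp
  have k2 [measurable]: "(\<lambda>t. k t s) \<in> borel_measurable M" if "s \<in> space M" for s
    using measurable_compose[OF measurable_Pair2'[OF that] k_meas] by simp
  have key: "A u \<in> borel_measurable M"
    "(\<integral>\<^sup>+t. ennreal ((cmod (A u t))\<^sup>2) \<partial>M) \<le> ennreal (B\<^sup>2 * (\<integral>s. (cmod (u s))\<^sup>2 \<partial>M))"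
    if u: "u \<in> L2_space M" for u
  proof -
    have [measurable]: "u \<in> borel_measurable M" and u_int: "integrable M (\<lambda>s. (cmod (u s))\<^sup>2)"
      using u by (auto simp: L2_space_def)
    show "A u \<in> borel_measurable M"
      unfolding A_def by (intro M.borel_measurable_lebesgue_integral) (simp add: case_prod_beta)
    have pointwise: "ennreal ((cmod (A u t))\<^sup>2) \<le>
        (\<integral>\<^sup>+s. ennreal (B * w t * (k t s * (cmod (u s))\<^sup>2 / w s)) \<partial>M)" if t: "t \<in> space M" for t
    proof -
      note [measurable] = k1[OF t]
      let ?f = "\<lambda>s. ennreal (sqrt (k t s * w s))"
      let ?g = "\<lambda>s. ennreal (sqrt (k t s / w s) * cmod (u s))"
      have fg: "ennreal (cmod (complex_of_real (k t s) * u s)) = ?f s * ?g s" if "s \<in> space M" for s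
      proof -
        have "sqrt (k t s * w s) * sqrt (k t s / w s) = k t s"
          using k_nonneg[OF t that] w_pos[OF that]
          by (simp add: real_sqrt_mult[symmetric] field_simps)
        then have "cmod (complex_of_real (k t s) * u s)
            = sqrt (k t s * w s) * (sqrt (k t s / w s) * cmod (u s))"
          using k_nonneg[OF t that] by (simp add: norm_mult mult.assoc[symmetric])
        then show ?thesis
          using k_nonneg[OF t that] w_pos[OF that] by (simp add: ennreal_mult)
      qed
      have "ennreal (cmod (A u t)) \<le> (\<integral>\<^sup>+s. ennreal (cmod (complex_of_real (k t s) * u s)) \<partial>M)"
        \<comment> \<open>If the integrand is not integrable, the left-hand side is 0 by convention.\<close>
      proof (cases "integrable M (\<lambda>s. complex_of_real (k t s) * u s)")
        case True
        then show ?thesis unfolding A_def by (rule integral_norm_bound_ennreal)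
      next
        case False
        then show ?thesis by (simp add: A_def not_integrable_integral_eq)
      qed
      also have "\<dots> = (\<integral>\<^sup>+s. ?f s * ?g s \<partial>M)"
        by (intro nn_integral_cong fg)
      finally have "(ennreal (cmod (A u t)))\<^sup>2 \<le> (\<integral>\<^sup>+s. ?f s * ?g s \<partial>M)\<^sup>2"
        by (intro power_mono) auto
      also have "\<dots> \<le> (\<integral>\<^sup>+s. ?f s ^ 2 \<partial>M) * (\<integral>\<^sup>+s. ?g s ^ 2 \<partial>M)"
        by (rule Cauchy_Schwarz_nn_integral) measurable
      also have "(\<integral>\<^sup>+s. ?f s ^ 2 \<partial>M) = (\<integral>\<^sup>+s. ennreal (k t s * w s) \<partial>M)"
        using k_nonneg[OF t] w_pos
        by (intro nn_integral_cong) (simp add: ennreal_power less_imp_le)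
      also have "(\<integral>\<^sup>+s. ?g s ^ 2 \<partial>M) = (\<integral>\<^sup>+s. ennreal (k t s * (cmod (u s))\<^sup>2 / w s) \<partial>M)"
        using k_nonneg[OF t] w_pos
        by (intro nn_integral_cong) (simp add: ennreal_power less_imp_le power_mult_distrib)
      also have "(\<integral>\<^sup>+s. ennreal (k t s * w s) \<partial>M) * \<dots> \<le> ennreal (B * w t) * \<dots>"
        by (intro mult_right_mono row t) simp
      also have "\<dots> = (\<integral>\<^sup>+s. ennreal (B * w t) * ennreal (k t s * (cmod (u s))\<^sup>2 / w s) \<partial>M)"
        by (rule nn_integral_cmult[symmetric]) measurable
      also have "\<dots> = (\<integral>\<^sup>+s. ennreal (B * w t * (k t s * (cmod (u s))\<^sup>2 / w s)) \<partial>M)"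
        using k_nonneg[OF t] w_pos w_pos[OF t] \<open>0 \<le> B\<close>
        by (intro nn_integral_cong ennreal_mult[symmetric]) (auto simp: less_imp_le)
      finally show ?thesis by (simp add: ennreal_power)
    qed
    have "(\<integral>\<^sup>+t. ennreal ((cmod (A u t))\<^sup>2) \<partial>M) \<le>
        (\<integral>\<^sup>+t. (\<integral>\<^sup>+s. ennreal (B * w t * (k t s * (cmod (u s))\<^sup>2 / w s)) \<partial>M) \<partial>M)"
      by (intro nn_integral_mono pointwise)
    also have "\<dots> = (\<integral>\<^sup>+s. (\<integral>\<^sup>+t. ennreal (B * w t * (k t s * (cmod (u s))\<^sup>2 / w s)) \<partial>M) \<partial>M)"
      by (rule MM.Fubini'[symmetric]) (simp add: case_prod_beta)
    also have "\<dots> \<le> (\<integral>\<^sup>+s. ennreal (B\<^sup>2 * (cmod (u s))\<^sup>2) \<partial>M)"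
    proof (intro nn_integral_mono)
      fix s assume s: "s \<in> space M"
      note [measurable] = k2[OF s]
      have "(\<integral>\<^sup>+t. ennreal (B * w t * (k t s * (cmod (u s))\<^sup>2 / w s)) \<partial>M)
          = (\<integral>\<^sup>+t. ennreal (B * (cmod (u s))\<^sup>2 / w s) * ennreal (k t s * w t) \<partial>M)"
        using k_nonneg[OF _ s] w_pos w_pos[OF s] \<open>0 \<le> B\<close>
        by (intro nn_integral_cong) (simp add: ennreal_mult[symmetric] less_imp_le mult_ac)
      also have "\<dots> = ennreal (B * (cmod (u s))\<^sup>2 / w s) * (\<integral>\<^sup>+t. ennreal (k t s * w t) \<partial>M)"
        by (rule nn_integral_cmult) measurable
      also have "\<dots> \<le> ennreal (B * (cmod (u s))\<^sup>2 / w s) * ennreal (B * w s)"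
        by (intro mult_left_mono col s) simp
      also have "\<dots> = ennreal (B\<^sup>2 * (cmod (u s))\<^sup>2)"
        using w_pos[OF s] \<open>0 \<le> B\<close>
        by (simp add: ennreal_mult[symmetric] less_imp_le power2_eq_square)
      finally show "(\<integral>\<^sup>+t. ennreal (B * w t * (k t s * (cmod (u s))\<^sup>2 / w s)) \<partial>M)
          \<le> ennreal (B\<^sup>2 * (cmod (u s))\<^sup>2)" .
    qed
    also have "\<dots> = ennreal (B\<^sup>2 * (\<integral>s. (cmod (u s))\<^sup>2 \<partial>M))"
      using u_int by (subst nn_integral_eq_integral) auto
    finally show "(\<integral>\<^sup>+t. ennreal ((cmod (A u t))\<^sup>2) \<partial>M)
        \<le> ennreal (B\<^sup>2 * (\<integral>s. (cmod (u s))\<^sup>2 \<partial>M))" .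
  qed
  have in_L2: "A u \<in> L2_space M" if "u \<in> L2_space M" for u
  proof -
    note [measurable] = key(1)[OF that]
    have "integrable M (\<lambda>t. (cmod (A u t))\<^sup>2)"
    proof (rule integrableI_nonneg)
      show "(\<integral>\<^sup>+t. ennreal ((cmod (A u t))\<^sup>2) \<partial>M) < \<infinity>"
        using key(2)[OF that] by (rule le_less_trans) simp
    qed auto
    then show ?thesis using key(1)[OF that] by (simp add: L2_space_def)
  qed
  have "L2_norm M (A u) \<le> B * L2_norm M u" if "u \<in> L2_space M" for u
  proof -
    have "ennreal (\<integral>t. (cmod (A u t))\<^sup>2 \<partial>M) = (\<integral>\<^sup>+t. ennreal ((cmod (A u t))\<^sup>2) \<partial>M)"
      using in_L2[OF that] by (intro nn_integral_eq_integral[symmetric]) (auto simp: L2_space_def)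
    also note key(2)[OF that]
    finally have "(\<integral>t. (cmod (A u t))\<^sup>2 \<partial>M) \<le> B\<^sup>2 * (\<integral>s. (cmod (u s))\<^sup>2 \<partial>M)"
      by (subst (asm) ennreal_le_iff) auto
    then have "L2_norm M (A u) \<le> sqrt (B\<^sup>2 * (\<integral>s. (cmod (u s))\<^sup>2 \<partial>M))"
      by (simp add: L2_norm_def)
    also have "\<dots> = B * L2_norm M u"
      using \<open>0 \<le> B\<close> by (simp add: L2_norm_def real_sqrt_mult)
    finally show ?thesis .
  qed
  then show ?thesis
    using in_L2 unfolding L2_bounded_def A_def by blast
qed

section \<open>Truncated Hankel operators and Hilbert's kernel\<close>

text \<open>
  The substitution \<open>s = t y\<^sup>2\<close> reduces the integral over the whole half-line to
  \<open>(2 / sqrt t) \<integral> dy / (1 + y\<^sup>2) = \<pi> / sqrt t\<close>, so \<open>1 / sqrt s\<close> satisfies the hypothesis of Schur's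
  test for Hilbert's kernel, with constant \<open>\<pi>\<close>. The corresponding antiderivative \<open>F\<close> is
  continuous but not differentiable at 0, whence the fundamental theorem of calculus on the open
  interval.
\<close>

lemma nn_integral_Hilbert_kernel_weight:
  fixes t T :: real
  assumes "0 < t" "0 < T"
  shows "(\<integral>\<^sup>+s. ennreal (1 / (t + s) * (1 / sqrt s)) \<partial>(lborel_upto T)) \<le> ennreal (pi / sqrt t)"
proof -
  define f where "f s = 1 / (t + s) * (1 / sqrt s)" for s
  define F where "F s = 2 / sqrt t * arctan (sqrt s / sqrt t)" for s
  have deriv: "DERIV F s :> f s" if "0 < s" for s
  proof -
    have "inverse (1 + (sqrt s / sqrt t)\<^sup>2) = t / (t + s)"
      using that assms by (simp add: power_divide field_simps)
    moreover have "2 / sqrt t * (t / (t + s) * (inverse (sqrt s) / 2 / sqrt t)) = f s"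
    proof -
      have "2 / sqrt t * (t / (t + s) * (inverse (sqrt s) / 2 / sqrt t))
          = t / (sqrt t * sqrt t) * f s"
        by (simp add: f_def inverse_eq_divide)
      then show ?thesis using assms by simp
    qed
    ultimately show ?thesis
      unfolding F_def
      by (intro DERIV_cong[OF DERIV_cmult[OF DERIV_chain2[OF DERIV_arctan
              DERIV_cdivide[OF DERIV_real_sqrt[OF that]]]]]) simp
  qed
  have cont_F: "isCont F s" for s
    unfolding F_def by (intro continuous_intros) (use assms in auto)
  have lim0: "((F \<circ> real_of_ereal) \<longlongrightarrow> F 0) (at_right (ereal 0))"
    unfolding ereal_tendsto_simps1
    by (rule tendsto_within_subset[OF isContD[OF cont_F]]) simp
  have limT: "((F \<circ> real_of_ereal) \<longlongrightarrow> F T) (at_left (ereal T))"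
    unfolding ereal_tendsto_simps1
    by (rule tendsto_within_subset[OF isContD[OF cont_F]]) simp
  have cont_f: "isCont f s" if "0 < s" for s
    unfolding f_def using that assms by (intro continuous_intros) auto
  have nonneg: "0 \<le> f s" if "0 < s" for s
    using that assms by (simp add: f_def)
  note FTC = interval_integral_FTC_nonneg[of "ereal 0" "ereal T" F f, OF _ _ _ _ lim0 limT]
  have int: "set_integrable lborel {0<..<T} f"
    using FTC(1) deriv cont_f nonneg assms by (auto simp: einterval_iff)
  have val: "(LINT s:{0<..<T}|lborel. f s) = F T - F 0"
    using FTC(2) deriv cont_f nonneg assms by (auto simp: interval_lebesgue_integral_le_eq)
  have "(\<integral>\<^sup>+s. ennreal (f s) \<partial>(lborel_upto T)) = (\<integral>\<^sup>+s. ennreal (indicator {0<..<T} s *\<^sub>R f s) \<partial>lborel)"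
    unfolding lborel_upto_def
    by (subst nn_integral_restrict_space) (auto intro!: nn_integral_cong split: split_indicator)
  also have "\<dots> = ennreal (F T - F 0)"
    unfolding val[symmetric] set_lebesgue_integral_def using int nonneg
    by (intro nn_integral_eq_integral) (auto simp: set_integrable_def split: split_indicator)
  also have "\<dots> \<le> ennreal (pi / sqrt t)"
  proof (rule ennreal_leI)
    have "arctan (sqrt T / sqrt t) \<le> pi / 2"
      using arctan_bounded[of "sqrt T / sqrt t"] by linarith
    then have "F T \<le> 2 / sqrt t * (pi / 2)"
      unfolding F_def using assms by (intro mult_left_mono) auto
    then show "F T - F 0 \<le> pi / sqrt t" by (simp add: F_def)
  qed
  finally show ?thesis by (simp add: f_def)
qed

lemma L2_bounded_truncated_hankel:
  assumes "0 < T" "0 \<le> K"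
    and meas: "h \<in> borel_measurable (restrict_space borel {0<..})"
    and nonneg: "\<And>t. 0 < t \<Longrightarrow> 0 \<le> h t"
    and le: "\<And>t. 0 < t \<Longrightarrow> t < 2 * T \<Longrightarrow> h t \<le> K / t"
  shows "L2_bounded (lborel_upto T) (truncated_hankel T h)"
proof -
  interpret finite_measure "lborel_upto T" by (rule finite_measure_lborel_upto)
  have bound: "(\<integral>\<^sup>+s. ennreal (h (t + s) * (1 / sqrt s)) \<partial>(lborel_upto T))
      \<le> ennreal (K * pi * (1 / sqrt t))" if t: "t \<in> {0<..<T}" for t
  proof -
    have [measurable]: "(\<lambda>s. 1 / (t + s) * (1 / sqrt s)) \<in> borel_measurable (lborel_upto T)"
      unfolding lborel_upto_def by (intro measurable_restrict_space1) measurable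
    have "(\<integral>\<^sup>+s. ennreal (h (t + s) * (1 / sqrt s)) \<partial>(lborel_upto T))
        \<le> (\<integral>\<^sup>+s. ennreal K * ennreal (1 / (t + s) * (1 / sqrt s)) \<partial>(lborel_upto T))"
    proof (intro nn_integral_mono)
      fix s assume s: "s \<in> space (lborel_upto T)"
      have "h (t + s) * (1 / sqrt s) \<le> K / (t + s) * (1 / sqrt s)"
        using s t by (intro mult_right_mono le) auto
      then show "ennreal (h (t + s) * (1 / sqrt s)) \<le> ennreal K * ennreal (1 / (t + s) * (1 / sqrt s))"
        using s t \<open>0 \<le> K\<close> by (subst ennreal_mult[symmetric]) (auto intro!: ennreal_leI)
    qed
    also have "\<dots> = ennreal K * (\<integral>\<^sup>+s. ennreal (1 / (t + s) * (1 / sqrt s)) \<partial>(lborel_upto T))"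
      by (rule nn_integral_cmult) measurable
    also have "\<dots> \<le> ennreal K * ennreal (pi / sqrt t)"
      using t \<open>0 < T\<close> by (intro mult_left_mono nn_integral_Hilbert_kernel_weight) auto
    also have "\<dots> = ennreal (K * pi * (1 / sqrt t))"
      using t \<open>0 \<le> K\<close> by (subst ennreal_mult[symmetric]) auto
    finally show ?thesis .
  qed
  have "L2_bounded (lborel_upto T)
      (\<lambda>u t. \<integral>s. complex_of_real (h (t + s)) * u s \<partial>(lborel_upto T))"
  proof (rule L2_bounded_Schur_test[where w = "\<lambda>s. 1 / sqrt s" and B = "K * pi"])
    show "(\<lambda>s. 1 / sqrt s) \<in> borel_measurable (lborel_upto T)"
      unfolding lborel_upto_def by (intro measurable_restrict_space1) measurable
    show "(\<integral>\<^sup>+t. ennreal (h (t + s) * (1 / sqrt t)) \<partial>(lborel_upto T))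
        \<le> ennreal (K * pi * (1 / sqrt s))" if "s \<in> space (lborel_upto T)" for s
      using bound[of s] that by (simp add: add.commute)
  qed (use assms bound borel_measurable_sum_kernel[OF meas] sigma_finite_measure_axioms in auto)
  then show ?thesis
    by (simp add: truncated_hankel_def[abs_def])
qed

text \<open>
  Testing on the indicator \<open>u\<close> of \<open>(0,e)\<close>: for \<open>t\<close> and \<open>s\<close> in \<open>(0,e)\<close> the argument \<open>t + s\<close> stays below
  \<open>2e\<close>, so the image of \<open>u\<close> is at least \<open>e * h (2e)\<close> on \<open>(0,e)\<close>, and the factors \<open>sqrt e\<close> in the norms
  on both sides cancel. That the image is square-integrable is essential here: only then does its
  \<open>L2_norm\<close> dominate this lower bound.
\<close>

lemma truncated_hankel_bounded_imp_le:
  assumes bdd: "L2_bounded (lborel_upto T) (truncated_hankel T h)"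
    and meas: "h \<in> borel_measurable (restrict_space borel {0<..})"
    and nonneg: "\<And>t. 0 < t \<Longrightarrow> 0 \<le> h t"
    and anti: "\<And>s t. 0 < s \<Longrightarrow> s \<le> t \<Longrightarrow> h t \<le> h s"
  shows "\<exists>C. \<forall>e. 0 < e \<and> e \<le> T \<longrightarrow> e * h (2 * e) \<le> C"
proof -
  let ?M = "lborel_upto T"
  interpret finite_measure ?M by (rule finite_measure_lborel_upto)
  obtain C where C: "\<And>u. u \<in> L2_space ?M \<Longrightarrow> L2_norm ?M (truncated_hankel T h u) \<le> C * L2_norm ?M u"
    and maps: "\<And>u. u \<in> L2_space ?M \<Longrightarrow> truncated_hankel T h u \<in> L2_space ?M"
    using bdd unfolding L2_bounded_def by blast
  have "e * h (2 * e) \<le> C" if e: "0 < e" "e \<le> T" for e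
  proof -
    let ?I = "{0<..<e}"
    define u :: "real \<Rightarrow> complex" where "u s = complex_of_real (indicator ?I s)" for s
    have I_sets [measurable]: "?I \<in> sets ?M"
      using e by (auto simp: lborel_upto_def sets_restrict_space_iff)
    have meas_I: "measure ?M ?I = e"
      using emeasure_lborel_upto[of 0 e T] e by (simp add: measure_def)
    have int_I: "integrable ?M (\<lambda>s. c * indicator ?I s)" for c :: real
      by (intro integrable_mult_right integrable_real_indicator I_sets) (simp add: emeasure_finite less_top[symmetric])
    have u_sq: "(cmod (u s))\<^sup>2 = indicator ?I s" for s
      by (simp add: u_def split: split_indicator)
    have u_meas [measurable]: "u \<in> borel_measurable ?M"
      unfolding u_def by measurable
    have u: "u \<in> L2_space ?M"
      using int_I[of 1] by (simp add: L2_space_def u_sq)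
    have norm_u: "L2_norm ?M u = sqrt e"
      using e by (simp add: L2_norm_def u_sq meas_I Int_absorb2)
    have lower: "e * h (2 * e) \<le> cmod (truncated_hankel T h u t)" if t: "t \<in> ?I" for t
    proof -
      have t': "t \<in> space ?M" using t e by simp
      have [measurable]: "(\<lambda>s. h (t + s)) \<in> borel_measurable ?M"
        using measurable_compose[OF measurable_Pair1'[OF t'] borel_measurable_sum_kernel[OF meas]] by simp
      \<comment> \<open>\<open>h\<close> may be unbounded near 0, but \<open>t + s\<close> stays above the fixed \<open>t > 0\<close>.\<close>
      have int: "integrable ?M (\<lambda>s. h (t + s) * indicator ?I s)"
      proof (rule integrable_const_bound[where B = "h t"])
        show "AE s in ?M. norm (h (t + s) * indicator ?I s) \<le> h t"
          using t nonneg anti[of t] by (intro AE_I2) (auto split: split_indicator)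
      qed measurable
      have "e * h (2 * e) = (\<integral>s. h (2 * e) * indicator ?I s \<partial>?M)"
        using e by (simp add: meas_I Int_absorb2)
      also have "\<dots> \<le> (\<integral>s. h (t + s) * indicator ?I s \<partial>?M)"
        using t by (intro integral_mono int_I int) (auto intro!: anti split: split_indicator)
      also have "\<dots> \<le> cmod (complex_of_real \<dots>)"
        by simp
      also have "complex_of_real (\<integral>s. h (t + s) * indicator ?I s \<partial>?M) = truncated_hankel T h u t"
        unfolding truncated_hankel_def u_def
        by (subst integral_complex_of_real[symmetric]) simp
      finally show ?thesis .
    qed
    have h0: "0 \<le> e * h (2 * e)" using nonneg e by simp
    have "(e * h (2 * e))\<^sup>2 * e = (\<integral>t. (e * h (2 * e))\<^sup>2 * indicator ?I t \<partial>?M)"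
      using e by (simp add: meas_I Int_absorb2)
    also have "\<dots> \<le> (\<integral>t. (cmod (truncated_hankel T h u t))\<^sup>2 \<partial>?M)"
      using maps[OF u] lower h0
      by (intro integral_mono int_I) (auto simp: L2_space_def split: split_indicator intro!: power_mono)
    finally have "sqrt ((e * h (2 * e))\<^sup>2 * e) \<le> L2_norm ?M (truncated_hankel T h u)"
      by (simp add: L2_norm_def)
    also have "\<dots> \<le> C * sqrt e"
      using C[OF u] by (simp add: norm_u)
    finally have "e * h (2 * e) * sqrt e \<le> C * sqrt e"
      using h0 by (simp add: real_sqrt_mult)
    then show ?thesis using e by simp
  qed
  then show ?thesis by blast
qed

section \<open>Laplace transforms and growth of the measure\<close>

lemma laplace_antimono:
  fixes \<mu> :: "real measure"
  assumes "sets \<mu> = sets (restrict_space borel {0<..})"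
    and lap: "\<And>t. 0 < t \<Longrightarrow> has_bochner_integral \<mu> (\<lambda>s. exp (- (s * t))) (h t)"
    and "0 < a" "a \<le> b"
  shows "h b \<le> h a"
proof -
  have sp: "space \<mu> = {0<..}"
    using sets_eq_imp_space_eq[OF assms(1)] by (simp add: space_restrict_space)
  show ?thesis
  proof -
    have "(\<integral>s. exp (- (s * b)) \<partial>\<mu>) \<le> (\<integral>s. exp (- (s * a)) \<partial>\<mu>)"
      using lap[of a] lap[of b] assms(3,4)
      by (intro integral_mono) (auto simp: has_bochner_integral_iff sp mult_left_mono)
    then show ?thesis
      using lap[of a] lap[of b] assms(3,4) by (simp add: has_bochner_integral_iff)
  qed
qed

lemma laplace_nonneg:
  fixes \<mu> :: "real measure"
  assumes "has_bochner_integral \<mu> (\<lambda>s. exp (- (s * t))) a"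
  shows "0 \<le> a"
  using assms integral_nonneg_AE[of "\<lambda>s. exp (- (s * t))" \<mu>] by (auto simp: has_bochner_integral_iff)

text \<open>
  Chebyshev's argument: \<open>exp ((x - s) * t) \<ge> 1\<close> for \<open>s < x\<close>. With \<open>t\<close> of the order \<open>1/x\<close> the
  exponential factor is a constant.
\<close>

lemma emeasure_le_laplace:
  fixes \<mu> :: "real measure"
  assumes "sets \<mu> = sets (restrict_space borel {0<..})"
    and lap: "has_bochner_integral \<mu> (\<lambda>s. exp (- (s * t))) a"
    and "0 < t"
  shows "emeasure \<mu> {0<..<x} \<le> ennreal (exp (x * t) * a)"
proof -
  have A [measurable]: "{0<..<x} \<in> sets \<mu>"
    unfolding assms(1) by (auto simp: sets_restrict_space_iff)
  have int: "integrable \<mu> (\<lambda>s. exp (- (s * t)))" and a: "(\<integral>s. exp (- (s * t)) \<partial>\<mu>) = a"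
    using lap by (auto simp: has_bochner_integral_iff)
  have "emeasure \<mu> {0<..<x} = (\<integral>\<^sup>+s. indicator {0<..<x} s \<partial>\<mu>)"
    by simp
  also have "\<dots> \<le> (\<integral>\<^sup>+s. ennreal (exp (x * t) * exp (- (s * t))) \<partial>\<mu>)"
    using \<open>0 < t\<close> by (intro nn_integral_mono)
      (auto simp: exp_add[symmetric] split: split_indicator)
  also have "\<dots> = ennreal (exp (x * t) * a)"
    using int unfolding a[symmetric] by (subst nn_integral_eq_integral) auto
  finally show ?thesis .
qed

text \<open>
  On the slice \<open>k \<le> s * t < k + 1\<close> the exponential is at most \<open>exp (-k)\<close>, and the slice lies in
  \<open>(0, (k + 1) / t)\<close>. Hence \<open>h t\<close> is at most \<open>(K / t) \<Sum>k. (k + 1) exp (-k)\<close>, and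
  \<open>k + 1 \<le> 2 exp (k/2)\<close> dominates this by a geometric series of ratio \<open>exp (-1/2)\<close>. Only intervals
  \<open>(0,x)\<close> with \<open>x \<ge> 1/t\<close> occur.
\<close>

lemma laplace_le_of_linear_growth:
  fixes \<mu> :: "real measure"
  assumes "sets \<mu> = sets (restrict_space borel {0<..})"
    and lap: "has_bochner_integral \<mu> (\<lambda>s. exp (- (s * t))) a"
    and "0 < t" "0 \<le> K"
    and growth: "\<And>x. 1 / t \<le> x \<Longrightarrow> emeasure \<mu> {0<..<x} \<le> ennreal (K * x)"
  shows "a \<le> 2 / (1 - exp (- 1 / 2)) * K / t"
proof -
  have sp: "space \<mu> = {0<..}"
    using sets_eq_imp_space_eq[OF assms(1)] by (simp add: space_restrict_space)
  have A [measurable]: "{0<..<x} \<in> sets \<mu>" for x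
    unfolding assms(1) by (auto simp: sets_restrict_space_iff)
  let ?r = "exp (- 1 / 2) :: real"
  have int: "integrable \<mu> (\<lambda>s. exp (- (s * t)))" and a: "(\<integral>s. exp (- (s * t)) \<partial>\<mu>) = a"
    using lap by (auto simp: has_bochner_integral_iff)
  have "ennreal a = (\<integral>\<^sup>+s. ennreal (exp (- (s * t))) \<partial>\<mu>)"
    using int unfolding a[symmetric] by (subst nn_integral_eq_integral) auto
  also have "\<dots> \<le> (\<integral>\<^sup>+s. (\<Sum>k. ennreal (exp (- real k)) * indicator {0<..<(real k + 1) / t} s) \<partial>\<mu>)"
  proof (intro nn_integral_mono)
    fix s assume "s \<in> space \<mu>"
    then have s: "0 < s" by (simp add: sp)
    define k where "k = nat \<lfloor>s * t\<rfloor>"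
    have k: "real k \<le> s * t" "s * t < real k + 1"
      using s \<open>0 < t\<close> unfolding k_def by (auto simp: of_nat_nat)
    let ?g = "\<lambda>k. ennreal (exp (- real k)) * indicator {0<..<(real k + 1) / t} s"
    have "ennreal (exp (- (s * t))) \<le> ?g k"
      using k s \<open>0 < t\<close> by (simp add: field_simps)
    also have "?g k = sum ?g {k}"
      by (subst sum.insert) simp_all
    also have "\<dots> \<le> (\<Sum>k. ?g k)"
      by (rule sum_le_suminf) auto
    finally show "ennreal (exp (- (s * t))) \<le> (\<Sum>k. ?g k)" .
  qed
  also have "\<dots> = (\<Sum>k. ennreal (exp (- real k)) * emeasure \<mu> {0<..<(real k + 1) / t})"
    by (subst nn_integral_suminf) (auto simp: nn_integral_cmult)
  also have "\<dots> \<le> (\<Sum>k. ennreal (2 * K / t * ?r ^ k))"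
  proof (intro suminf_le)
    fix k
    have "emeasure \<mu> {0<..<(real k + 1) / t} \<le> ennreal (K * ((real k + 1) / t))"
      using \<open>0 < t\<close> by (intro growth) (auto simp: divide_right_mono)
    then have "ennreal (exp (- real k)) * emeasure \<mu> {0<..<(real k + 1) / t}
        \<le> ennreal (exp (- real k)) * ennreal (K * ((real k + 1) / t))"
      by (rule mult_left_mono) simp
    also have "\<dots> = ennreal (exp (- real k) * (K * ((real k + 1) / t)))"
      using \<open>0 < t\<close> \<open>0 \<le> K\<close> by (intro ennreal_mult[symmetric]) auto
    also have "\<dots> \<le> ennreal (2 * K / t * ?r ^ k)"
    proof (rule ennreal_leI)
      have "real k + 1 \<le> 2 * exp (real k / 2)"
        using exp_ge_add_one_self[of "real k / 2"] by linarith
      then have "exp (- real k) * (real k + 1) \<le> exp (- real k) * (2 * exp (real k / 2))"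
        by (intro mult_left_mono) auto
      also have "\<dots> = 2 * ?r ^ k"
        by (simp add: exp_of_nat_mult[symmetric] exp_add[symmetric])
      finally have "K / t * (exp (- real k) * (real k + 1)) \<le> K / t * (2 * ?r ^ k)"
        using \<open>0 < t\<close> \<open>0 \<le> K\<close> by (intro mult_left_mono) auto
      then show "exp (- real k) * (K * ((real k + 1) / t)) \<le> 2 * K / t * ?r ^ k"
        by (simp add: field_simps)
    qed
    finally show "ennreal (exp (- real k)) * emeasure \<mu> {0<..<(real k + 1) / t}
        \<le> ennreal (2 * K / t * ?r ^ k)" .
  qed auto
  also have "\<dots> = ennreal (2 * K / t * (1 / (1 - ?r)))"
  proof (rule suminf_ennreal_eq)
    show "(\<lambda>k. 2 * K / t * ?r ^ k) sums (2 * K / t * (1 / (1 - ?r)))"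
      by (intro sums_mult geometric_sums) simp
  qed (use \<open>0 < t\<close> \<open>0 \<le> K\<close> in auto)
  finally show ?thesis
    using \<open>0 < t\<close> \<open>0 \<le> K\<close> by (subst (asm) ennreal_le_iff) (auto simp: field_simps)
qed

theorem theorem4p1:
  fixes T :: real and \<mu> :: "real measure" and h :: "real \<Rightarrow> real"
  assumes "0 < T"
    and "sets \<mu> = sets (restrict_space borel {0<..})"
    and "\<And>t. 0 < t \<Longrightarrow> has_bochner_integral \<mu> (\<lambda>s. exp (- (s * t))) (h t)"
  shows "L2_bounded (lborel_upto T) (truncated_hankel T h) \<longleftrightarrow>
         (\<exists>C>0. \<forall>x\<ge>1. emeasure \<mu> {0<..<x} \<le> ennreal (C * x))"
proof -
  note lap = assms(3)
  have anti: "h t \<le> h s" if "0 < s" "s \<le> t" for s t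
    using laplace_antimono[OF assms(2) lap that] by simp
  have nonneg: "0 \<le> h t" if "0 < t" for t
    using laplace_nonneg[OF lap[OF that]] .
  have "(\<lambda>t. - h t) \<in> borel_measurable (restrict_space borel {0<..})"
    by (rule borel_measurable_mono_on_fnc) (auto intro!: mono_onI anti)
  from borel_measurable_uminus[OF this]
  have meas: "h \<in> borel_measurable (restrict_space borel {0<..})"
    by simp
  show ?thesis
  proof
    assume "L2_bounded (lborel_upto T) (truncated_hankel T h)"
    from truncated_hankel_bounded_imp_le[OF this meas nonneg anti]
    obtain C where C: "\<And>e. 0 < e \<Longrightarrow> e \<le> T \<Longrightarrow> e * h (2 * e) \<le> C" by blast
    \<comment> \<open>For \<open>x \<ge> 1\<close> the test length \<open>m / x\<close> is at most \<open>T\<close>, and the exponent \<open>x * (2 * (m / x))\<close>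
      is at most 1.\<close>
    define m where "m = min T (1/2)"
    have m: "0 < m" "m \<le> T" "2 * m \<le> 1" using \<open>0 < T\<close> by (auto simp: m_def)
    define D where "D = exp 1 * max C 1 / m"
    have "emeasure \<mu> {0<..<x} \<le> ennreal (D * x)" if x: "1 \<le> x" for x
    proof -
      let ?e = "m / x"
      have e: "0 < ?e" "?e \<le> T"
        using m x by (auto simp: field_simps intro: order_trans[OF _ mult_left_mono[of 1 x T]])
      have "emeasure \<mu> {0<..<x} \<le> ennreal (exp (x * (2 * ?e)) * h (2 * ?e))"
        using e by (intro emeasure_le_laplace[OF assms(2)] lap) auto
      also have "\<dots> \<le> ennreal (D * x)"
      proof (rule ennreal_leI)
        have "h (2 * ?e) \<le> max C 1 * x / m"
        proof -
          have "?e * h (2 * ?e) \<le> max C 1" using C[OF e] by simp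
          then show ?thesis using m x by (simp add: field_simps)
        qed
        moreover have "exp (x * (2 * ?e)) \<le> exp 1"
          using m x by simp
        ultimately have "exp (x * (2 * ?e)) * h (2 * ?e) \<le> exp 1 * (max C 1 * x / m)"
          using e by (intro mult_mono nonneg) auto
        then show "exp (x * (2 * ?e)) * h (2 * ?e) \<le> D * x"
          by (simp add: D_def)
      qed
      finally show ?thesis .
    qed
    moreover have "0 < D" using m by (simp add: D_def)
    ultimately show "\<exists>C>0. \<forall>x\<ge>1. emeasure \<mu> {0<..<x} \<le> ennreal (C * x)" by blast
  next
    assume "\<exists>C>0. \<forall>x\<ge>1. emeasure \<mu> {0<..<x} \<le> ennreal (C * x)"
    then obtain C where C: "0 < C" "\<And>x. 1 \<le> x \<Longrightarrow> emeasure \<mu> {0<..<x} \<le> ennreal (C * x)" by blast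
    \<comment> \<open>This constant extends the growth bound from \<open>x \<ge> 1\<close> down to \<open>x \<ge> 1 / (2T)\<close>, as is needed to
      control \<open>h\<close> on all of \<open>(0, 2T)\<close>.\<close>
    define K where "K = C * max 1 (2 * T)"
    have K: "0 < K" using C \<open>0 < T\<close> by (simp add: K_def)
    have growth: "emeasure \<mu> {0<..<x} \<le> ennreal (K * x)" if x: "1 / (2 * T) \<le> x" for x
    proof -
      have "0 < x" "1 \<le> 2 * T * x"
        using x \<open>0 < T\<close> by (auto simp: field_simps intro: less_le_trans[of 0 "1 / (2 * T)"])
      have [measurable]: "{0<..<max 1 x} \<in> sets \<mu>"
        unfolding assms(2) by (auto simp: sets_restrict_space_iff)
      have "emeasure \<mu> {0<..<x} \<le> emeasure \<mu> {0<..<max 1 x}"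
        by (intro emeasure_mono) auto
      also have "\<dots> \<le> ennreal (C * max 1 x)"
        by (rule C) simp
      also have "\<dots> \<le> ennreal (K * x)"
      proof (rule ennreal_leI)
        have "max 1 x \<le> max 1 (2 * T) * x"
          using \<open>0 < x\<close> \<open>1 \<le> 2 * T * x\<close> by (auto simp: max_def intro: order_trans)
        then show "C * max 1 x \<le> K * x"
          using C(1) by (simp add: K_def mult.assoc)
      qed
      finally show ?thesis .
    qed
    let ?c = "2 / (1 - exp (- 1 / 2)) :: real"
    show "L2_bounded (lborel_upto T) (truncated_hankel T h)"
    proof (rule L2_bounded_truncated_hankel[OF \<open>0 < T\<close> _ meas nonneg])
      show "0 \<le> ?c * K" using K by simp
      show "h t \<le> ?c * K / t" if t: "0 < t" "t < 2 * T" for t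
      proof (rule laplace_le_of_linear_growth[OF assms(2) lap])
        show "emeasure \<mu> {0<..<x} \<le> ennreal (K * x)" if "1 / t \<le> x" for x
          using t that by (intro growth order_trans[OF _ that]) (simp add: field_simps)
      qed (use t K in auto)
    qed
  qed
qed

end
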